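(* Let $P=\{P_\Lambda\}_{\Lambda\in\mathcal{N}}$ be a potential which either has finite range or is absolutely summable, and suppose that the functions $H_n$ are well defined and that $0<\mathbf{Z}_n^\omega<\infty$ for all $n\in\mathbb{N}$ and $\omega\in\Omega$. Then the family $\{\zeta_n^P\}_{n\in\mathbb{N}}$ of Boltzmann–Gibbs kernels is a specification (indexed by the balls $V_n$, $n\in\mathbb{N}$).
   Context: Let $V$ be the vertex set of the Cayley tree of order $k\ge1$ (the infinite tree in which every vertex has exactly $k+1$ edges), let $d$ be the graph distance, fix $x^0\in V$, and let $V_n=\{x\in V: d(x,x^0)\le n\}$ for $n\in\mathbb{N}=\{1,2,\dots\}$. Let $\Phi\subseteq[0,\infty]$ be a nonempty, at most countable set of spin values. Put $\Omega_A=\Phi^A$ for $A\subseteq V$ and $\Omega=\Phi^V$. For a finite set $A$ and $\sigma_A\in\Omega_A$, $\omega\in\Omega$, write $\sigma_A\omega_{A^c}$ for the configuration equal to $\sigma_A$ on $A$ and to $\omega$ on $A^c=V\setminus A$. Let $\mathcal{N}$ be the set of finite subsets of $V$. Let $\mathcal{F}$ be the $\sigma$-algebra on $\Omega$ generated by the sets $\{\sigma\in\Omega:\sigma|_A\in B\}$ with $A\in\mathcal{N}$, $B\subseteq\Phi^A$. For $\Lambda\in\mathcal{N}$ let $\mathcal{F}_\Lambda$ be the sub-$\sigma$-algebra generated by those sets with $A\cap\Lambda=\varnothing$ (events outside $\Lambda$); this family is decreasing in $\Lambda$. A potential is a collection $P=\{P_\Lambda\}_{\Lambda\in\mathcal{N}}$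 of maps $P_\Lambda:\Omega\to\mathbb{R}\cup\{-\infty,\infty\}$ such that $P_\Lambda(\sigma)$ depends only on $\sigma|_\Lambda$. It has finite range if there is $R>0$ with $P_\Lambda\equiv0$ whenever $\operatorname{diam}(\Lambda)>R$. It is absolutely summable if $\sum_{\Lambda\in\mathcal{N},\,\Lambda\ni x}\|P_\Lambda\|_\infty<\infty$ for every $x\in V$, where $\|f\|_\infty=\sup_\omega|f(\omega)|$. The Hamiltonian in the box $V_n$ is the sum over the boxes $$H_n(\sigma)=\sum_{j\in\mathbb{N}}P_{V_j}(\sigma),\qquad \sigma\in\Omega$$ (all boxes $V_j$ intersect $V_n$). For $n\in\mathbb{N}$, $\omega\in\Omega$ and $\sigma_n\in\Omega_{V_n}$ put $$\zeta_n^P(\omega,\sigma_n)=\frac{1}{\mathbf{Z}_n^\omega}e^{-H_n(\sigma_n\omega_{V_n^c})},\qquad \mathbf{Z}_n^\omega=\sum_{\sigma_n\in\Omega_{V_n}}e^{-H_n(\sigma_n\omega_{V_n^c})},$$ with $e^{-\infty}=0$. This is viewed as a kernel on $\Omega\times\mathcal{F}$ through $$\zeta_n^P(\omega,A)=\sum_{\sigma_n\in\Omega_{V_n}}\mathbf{1}_A(\sigma_n\omega_{V_n^c})\,\zeta_n^P(\omega,\sigma_n),\qquad A\in\mathcal{F}.$$ A family of kernels $\{\zeta_n\}_{n\in\mathbb{N}}$ on $\Omega\times\mathcal{F}$ is a specification if: (i) for each $n$ and $\omega$, $\zeta_n(\omega,\cdot)$ is a measure on $\mathcal{F}$ with total mass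 $0$ or $1$; (ii) for each $n$ and $A\in\mathcal{F}$, $\zeta_n(\cdot,A)$ is $\mathcal{F}_{V_n}$-measurable; (iii) each $\zeta_n$ is strict (proper): $\zeta_n(\omega,B)=\mathbf{1}_B(\omega)$ for all $\omega\in\Omega$ and $B\in\mathcal{F}_{V_n}$; (iv) $\zeta_m\zeta_n=\zeta_m$ whenever $V_n\subseteq V_m$, where $(\zeta_m\zeta_n)(\omega,A)=\int_\Omega\zeta_n(\tau,A)\,\zeta_m(\omega,d\tau)$. *)

theory Defs
  imports "HOL-Analysis.Analysis" "Graph_Theory.Graph_Theory"
begin

section \<open>The Cayley tree\<close>

text \<open>
  An undirected simple graph is a symmetric loop-free digraph whose arcs are pairs of vertices;
  every edge then contributes exactly one outgoing arc at each endpoint.  The digraph notion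
  of cycle counts going along an edge and straight back as a cycle (of length 2), so
  \<open>tree\<close> from the graph library is not applicable; the cycles of the undirected graph are those
  of length at least 3.  \<open>connected\<close> includes non-emptiness.
\<close>

locale cayley_tree = pair_bidirected_digraph G for G :: "'v pair_pre_digraph" +
  fixes k :: nat
  assumes order: "k \<ge> 1"
    and connectedness: "Digraph_Component.connected (with_proj G)"
    and acyclic: "\<not> (\<exists>p. pre_digraph.cycle (with_proj G) p \<and> length p \<ge> 3)"
    and degree: "\<And>v. v \<in> pverts G \<Longrightarrow> out_degree (with_proj G) v = k + 1"

text \<open>\<open>wf_digraph.\<mu>\<close> is the least weight of a walk; with unit weights, this is the graph distance.\<close>

definition graph_dist :: "'v pair_pre_digraph \<Rightarrow> 'v \<Rightarrow> 'v \<Rightarrow> ereal" where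
  "graph_dist G x y = wf_digraph.\<mu> (with_proj G) (\<lambda>_. 1) x y"

definition graph_diam :: "'v pair_pre_digraph \<Rightarrow> 'v set \<Rightarrow> ereal" where
  "graph_diam G \<Lambda> = (SUP x\<in>\<Lambda>. SUP y\<in>\<Lambda>. graph_dist G x y)"

definition vertex_box :: "'v pair_pre_digraph \<Rightarrow> 'v \<Rightarrow> nat \<Rightarrow> 'v set" where
  "vertex_box G x0 n = {x \<in> pverts G. graph_dist G x x0 \<le> ereal (real n)}"


section \<open>Events\<close>

text \<open>
  The configuration space over \<open>A\<close> is \<open>A \<rightarrow>\<^sub>E \<Phi>\<close>.  \<open>events V \<Phi> S\<close> is the \<open>\<sigma>\<close>-algebra on
  \<open>V \<rightarrow>\<^sub>E \<Phi>\<close> generated by the cylinders with finite base inside \<open>S\<close>: the full \<open>\<sigma>\<close>-algebra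
  \<open>\<F>\<close> is \<open>events V \<Phi> V\<close>, and \<open>\<F>\<^sub>\<Lambda>\<close> (events outside \<open>\<Lambda>\<close>) is \<open>events V \<Phi> (V - \<Lambda>)\<close>.
  Only the sets of this \<open>measure\<close> are meaningful.
\<close>

definition events :: "'v set \<Rightarrow> 's set \<Rightarrow> 'v set \<Rightarrow> ('v \<Rightarrow> 's) measure" where
  "events V \<Phi> S = sigma (V \<rightarrow>\<^sub>E \<Phi>)
     {{\<sigma> \<in> V \<rightarrow>\<^sub>E \<Phi>. restrict \<sigma> A \<in> B} | A B. finite A \<and> A \<subseteq> S \<and> B \<subseteq> (A \<rightarrow>\<^sub>E \<Phi>)}"


section \<open>Potentials\<close>

type_synonym ('v, 's) potential = "'v set \<Rightarrow> ('v \<Rightarrow> 's) \<Rightarrow> ereal"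

definition is_potential :: "'v set \<Rightarrow> 's set \<Rightarrow> ('v, 's) potential \<Rightarrow> bool" where
  "is_potential V \<Phi> P \<longleftrightarrow>
     (\<forall>\<Lambda>. finite \<Lambda> \<and> \<Lambda> \<subseteq> V \<longrightarrow>
        (\<forall>\<sigma> \<in> V \<rightarrow>\<^sub>E \<Phi>. \<forall>\<tau> \<in> V \<rightarrow>\<^sub>E \<Phi>. restrict \<sigma> \<Lambda> = restrict \<tau> \<Lambda> \<longrightarrow> P \<Lambda> \<sigma> = P \<Lambda> \<tau>))"

definition finite_range :: "'v pair_pre_digraph \<Rightarrow> 's set \<Rightarrow> ('v, 's) potential \<Rightarrow> bool" where
  "finite_range G \<Phi> P \<longleftrightarrow>
     (\<exists>R::real. R > 0 \<and>
        (\<forall>\<Lambda>. finite \<Lambda> \<and> \<Lambda> \<subseteq> pverts G \<and> graph_diam G \<Lambda> > ereal R \<longrightarrow>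
           (\<forall>\<sigma> \<in> pverts G \<rightarrow>\<^sub>E \<Phi>. P \<Lambda> \<sigma> = 0)))"

definition sup_norm :: "'v set \<Rightarrow> 's set \<Rightarrow> (('v \<Rightarrow> 's) \<Rightarrow> ereal) \<Rightarrow> ennreal" where
  "sup_norm V \<Phi> f = (SUP \<omega> \<in> V \<rightarrow>\<^sub>E \<Phi>. e2ennreal \<bar>f \<omega>\<bar>)"

definition abs_summable :: "'v set \<Rightarrow> 's set \<Rightarrow> ('v, 's) potential \<Rightarrow> bool" where
  "abs_summable V \<Phi> P \<longleftrightarrow>
     (\<forall>x\<in>V. (\<Sum>\<^sub>\<infinity>\<Lambda> \<in> {\<Lambda>. finite \<Lambda> \<and> \<Lambda> \<subseteq> V \<and> x \<in> \<Lambda>}. sup_norm V \<Phi> (P \<Lambda>)) < \<infinity>)"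


section \<open>Hamiltonians and Boltzmann--Gibbs kernels\<close>

text \<open>
  The sum defining the Hamiltonian in the box of radius \<open>n\<close> runs over all boxes of radius
  \<open>j \<ge> 1\<close> that meet that box, that is, over all boxes; it therefore does not depend on \<open>n\<close>.
  It is well defined if it contains no \<open>\<infinity> - \<infinity>\<close> and its partial sums converge in
  \<open>[-\<infinity>, \<infinity>]\<close>.  The first condition has to be stated separately because the library
  sets \<open>\<infinity> + (-\<infinity>) = \<infinity>\<close>.
\<close>

definition hamiltonian ::
  "'v pair_pre_digraph \<Rightarrow> 'v \<Rightarrow> ('v, 's) potential \<Rightarrow> nat \<Rightarrow> ('v \<Rightarrow> 's) \<Rightarrow> ereal" where
  "hamiltonian G x0 P n \<sigma> = (\<Sum>j. P (vertex_box G x0 (Suc j)) \<sigma>)"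

definition hamiltonian_well_defined ::
  "'v pair_pre_digraph \<Rightarrow> 'v \<Rightarrow> ('v, 's) potential \<Rightarrow> nat \<Rightarrow> ('v \<Rightarrow> 's) \<Rightarrow> bool" where
  "hamiltonian_well_defined G x0 P n \<sigma> \<longleftrightarrow>
     \<not> (\<exists>i j. P (vertex_box G x0 (Suc i)) \<sigma> = \<infinity> \<and> P (vertex_box G x0 (Suc j)) \<sigma> = -\<infinity>) \<and>
     summable (\<lambda>j. P (vertex_box G x0 (Suc j)) \<sigma>)"

definition exp_uminus :: "ereal \<Rightarrow> ennreal" where
  "exp_uminus h = (case h of ereal r \<Rightarrow> ennreal (exp (- r)) | PInfty \<Rightarrow> 0 | MInfty \<Rightarrow> \<infinity>)"

text \<open>\<open>override_on \<omega> \<sigma> A\<close> is the configuration equal to \<open>\<sigma>\<close> on \<open>A\<close> and to \<open>\<omega>\<close> off \<open>A\<close>.\<close>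

definition partition_function ::
  "'v pair_pre_digraph \<Rightarrow> 'v \<Rightarrow> 's set \<Rightarrow> ('v, 's) potential \<Rightarrow> nat \<Rightarrow> ('v \<Rightarrow> 's) \<Rightarrow> ennreal" where
  "partition_function G x0 \<Phi> P n \<omega> =
     (\<Sum>\<^sub>\<infinity>\<sigma> \<in> vertex_box G x0 n \<rightarrow>\<^sub>E \<Phi>.
        exp_uminus (hamiltonian G x0 P n (override_on \<omega> \<sigma> (vertex_box G x0 n))))"

definition gibbs_weight ::
  "'v pair_pre_digraph \<Rightarrow> 'v \<Rightarrow> 's set \<Rightarrow> ('v, 's) potential \<Rightarrow> nat \<Rightarrow>
     ('v \<Rightarrow> 's) \<Rightarrow> ('v \<Rightarrow> 's) \<Rightarrow> ennreal" where
  "gibbs_weight G x0 \<Phi> P n \<omega> \<sigma> =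
     exp_uminus (hamiltonian G x0 P n (override_on \<omega> \<sigma> (vertex_box G x0 n)))
       / partition_function G x0 \<Phi> P n \<omega>"

definition gibbs_kernel ::
  "'v pair_pre_digraph \<Rightarrow> 'v \<Rightarrow> 's set \<Rightarrow> ('v, 's) potential \<Rightarrow> nat \<Rightarrow>
     ('v \<Rightarrow> 's) \<Rightarrow> ('v \<Rightarrow> 's) set \<Rightarrow> ennreal" where
  "gibbs_kernel G x0 \<Phi> P n \<omega> A =
     (\<Sum>\<^sub>\<infinity>\<sigma> \<in> vertex_box G x0 n \<rightarrow>\<^sub>E \<Phi>.
        indicator A (override_on \<omega> \<sigma> (vertex_box G x0 n)) * gibbs_weight G x0 \<Phi> P n \<omega> \<sigma>)"


section \<open>Specifications\<close>

definition is_specification ::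
  "'v set \<Rightarrow> 's set \<Rightarrow> (nat \<Rightarrow> 'v set) \<Rightarrow>
     (nat \<Rightarrow> ('v \<Rightarrow> 's) \<Rightarrow> ('v \<Rightarrow> 's) set \<Rightarrow> ennreal) \<Rightarrow> bool" where
  "is_specification V \<Phi> W \<zeta> \<longleftrightarrow>
     (\<forall>n\<ge>1. \<forall>\<omega> \<in> V \<rightarrow>\<^sub>E \<Phi>.
        measure_space (V \<rightarrow>\<^sub>E \<Phi>) (sets (events V \<Phi> V)) (\<zeta> n \<omega>) \<and>
        \<zeta> n \<omega> (V \<rightarrow>\<^sub>E \<Phi>) \<in> {0, 1}) \<and>
     (\<forall>n\<ge>1. \<forall>A \<in> sets (events V \<Phi> V).
        (\<lambda>\<omega>. \<zeta> n \<omega> A) \<in> borel_measurable (events V \<Phi> (V - W n))) \<and>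
     (\<forall>n\<ge>1. \<forall>\<omega> \<in> V \<rightarrow>\<^sub>E \<Phi>. \<forall>B \<in> sets (events V \<Phi> (V - W n)).
        \<zeta> n \<omega> B = indicator B \<omega>) \<and>
     (\<forall>m\<ge>1. \<forall>n\<ge>1. W n \<subseteq> W m \<longrightarrow>
        (\<forall>\<omega> \<in> V \<rightarrow>\<^sub>E \<Phi>. \<forall>A \<in> sets (events V \<Phi> V).
           (\<integral>\<^sup>+ \<tau>. \<zeta> n \<tau> A \<partial>measure_of (V \<rightarrow>\<^sub>E \<Phi>) (sets (events V \<Phi> V)) (\<zeta> m \<omega>))
             = \<zeta> m \<omega> A))"

end

theory Submission
  imports Defs
begin

text \<open>
  The Hamiltonian does not depend on the box, so all kernels come from one weight
  \<open>w = exp (- H)\<close>.  Consistency \<open>\<zeta>\<^sub>m \<zeta>\<^sub>n = \<zeta>\<^sub>m\<close> then reduces to a swap: resampling a configuration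
  \<open>s\<close> on the larger box by \<open>t\<close> on the smaller one is undone by the involution that exchanges
  \<open>t\<close> with the part of \<open>s\<close> it overwrites, and after the exchange the inner sum is the partition
  function of the smaller box, which cancels.
\<close>

section \<open>Finiteness of the boxes\<close>

context cayley_tree
begin

text \<open>\<open>card\<close> of an infinite set is 0, so the out-degree \<open>k + 1\<close>,
  being positive, forces finiteness.\<close>

lemma finite_out_arcs_cayley:
  assumes "v \<in> pverts G"
  shows "finite (out_arcs (with_proj G) v)"
  using degree[OF assms] unfolding out_degree_def by (intro card_ge_0_finite) simp

text \<open>Induction on the length bound. A nonempty walk from \<open>x\<close> starts with an arc
  to some \<open>y\<close> in the smaller ball; by symmetry the reversed arc leaves
  \<open>y\<close>, so \<open>x\<close> is one of the finitely many out-neighbours of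
  \<open>y\<close>.\<close>

lemma finite_walk_ball:
  "finite {x. \<exists>p. awalk x p x0 \<and> length p \<le> n}" (is "finite (?B n)")
proof (induction n)
  case 0
  have "?B 0 \<subseteq> {x0}" by (auto simp: awalk_Nil_iff)
  then show ?case by (rule finite_subset) simp
next
  case (Suc n)
  have "?B (Suc n) \<subseteq> insert x0 (\<Union>y\<in>?B n. snd ` out_arcs (with_proj G) y)"
  proof
    fix x assume "x \<in> ?B (Suc n)"
    then obtain p where p: "awalk x p x0" "length p \<le> Suc n" by blast
    show "x \<in> insert x0 (\<Union>y\<in>?B n. snd ` out_arcs (with_proj G) y)"
    proof (cases p)
      case Nil
      with p show ?thesis by (simp add: awalk_Nil_iff)
    next
      case (Cons e q)
      with p have e: "e \<in> parcs G" "x = fst e" "awalk (snd e) q x0" "length q \<le> n"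
        by (auto simp: awalk_Cons_iff)
      then have "(snd e, x) \<in> out_arcs (with_proj G) (snd e)"
        using arcs_symmetric[of "fst e" "snd e"] by simp
      with e show ?thesis by force
    qed
  qed
  moreover have "finite (out_arcs (with_proj G) y)" if "y \<in> ?B n" for y
  proof -
    from that have "y \<in> pverts G" by (auto dest: awalk_hd_in_verts)
    then show ?thesis by (rule finite_out_arcs_cayley)
  qed
  ultimately show ?case
    using Suc.IH by (elim finite_subset) auto
qed

lemma finite_vertex_box: "finite (vertex_box G x0 n)"
proof (rule finite_subset[OF _ finite_walk_ball])
  show "vertex_box G x0 n \<subseteq> {x. \<exists>p. awalk x p x0 \<and> length p \<le> n}"
  proof
    fix x assume "x \<in> vertex_box G x0 n"
    then have "(INF p\<in>{p. awalk x p x0}. ereal (awalk_cost (\<lambda>_. 1) p)) \<le> ereal (real n)"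
      by (simp add: vertex_box_def graph_dist_def \<mu>_def)
    \<comment> \<open>The distance is an infimum over walks. The strict bound \<open>n + 1\<close>
      yields an actual walk below it, and since its cost is its integer length, that length is at
      most \<open>n\<close>.\<close>
    also have "\<dots> < ereal (real n + 1)" by simp
    finally obtain p where p: "awalk x p x0" "awalk_cost (\<lambda>_. 1) p < real n + 1"
      by (auto simp: INF_less_iff)
    then have "length p \<le> n" by (simp add: awalk_cost_def sum_list_triv)
    with p show "x \<in> {x. \<exists>p. awalk x p x0 \<and> length p \<le> n}" by blast
  qed
qed

end

lemma vertex_box_subset: "vertex_box G x0 n \<subseteq> pverts G"
  by (auto simp: vertex_box_def)


section \<open>Countable sums\<close>

text \<open>Bridge from the unordered sums in the definitions of the kernels to integrals over
  counting measure, where Tonelli, linearity and change of variables can be applied.\<close>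

lemma infsum_ennreal_eq_nn_integral:
  fixes f :: "'a \<Rightarrow> ennreal"
  assumes "countable A"
  shows "infsum f A = (\<integral>\<^sup>+ x. f x \<partial>count_space A)"
proof (cases "finite A")
  case True
  then show ?thesis by (simp add: nn_integral_count_space_finite)
next
  case False
  then have b: "bij_betw (from_nat_into A) UNIV A"
    using assms by (simp add: bij_betw_from_nat_into)
  have "infsum f A = (\<Sum>\<^sub>\<infinity>i. f (from_nat_into A i))"
    using infsum_reindex_bij_betw[OF b, of f] by simp
  also have "\<dots> = (\<Sum>i. f (from_nat_into A i))"
    by (intro sums_unique has_sum_imp_sums has_sum_infsum nonneg_summable_on_complete) simp
  also have "\<dots> = (\<integral>\<^sup>+ x. f x \<partial>count_space A)"
    using nn_integral_bij_count_space[OF b, of f] by (simp add: nn_integral_count_space_nat)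
  finally show ?thesis .
qed

text \<open>For countable \<open>A\<close>, measurability of every section gives joint
  measurability, and the counting measure is sigma-finite, so integrating out \<open>a\<close>
  preserves measurability.\<close>

lemma borel_measurable_nn_integral_count_space:
  fixes f :: "'a \<Rightarrow> 'b \<Rightarrow> ennreal"
  assumes "countable A" and "\<And>a. a \<in> A \<Longrightarrow> f a \<in> borel_measurable N"
  shows "(\<lambda>x. \<integral>\<^sup>+ a. f a x \<partial>count_space A) \<in> borel_measurable N"
proof -
  interpret sigma_finite_measure "count_space A"
    using assms(1) by (rule sigma_finite_measure_count_space_countable)
  have "(\<lambda>(a, x). f a x) \<in> borel_measurable (count_space A \<Otimes>\<^sub>M N)"
    using assms by (intro measurable_pair_measure_countable1) auto
  from measurable_compose[OF measurable_pair_swap' this]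
  show ?thesis
    by (intro borel_measurable_nn_integral) (simp add: split_beta)
qed


section \<open>Events\<close>

lemma space_events [simp]: "space (events V \<Phi> S) = V \<rightarrow>\<^sub>E \<Phi>"
  by (auto simp: events_def intro!: space_measure_of)

lemma sets_events:
  "sets (events V \<Phi> S) = sigma_sets (V \<rightarrow>\<^sub>E \<Phi>)
     {{\<sigma> \<in> V \<rightarrow>\<^sub>E \<Phi>. restrict \<sigma> A \<in> B} | A B. finite A \<and> A \<subseteq> S \<and> B \<subseteq> (A \<rightarrow>\<^sub>E \<Phi>)}"
  unfolding events_def by (rule sets_measure_of) blast

text \<open>Such a set is itself a generating cylinder: its base is its image under restriction to
  \<open>A\<close>, and every subset of the configurations on \<open>A\<close> is allowed as a
  base.\<close>

lemma local_event:
  assumes "S \<subseteq> V" "finite A" "A \<subseteq> S"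
    and loc: "\<And>\<sigma> \<tau>. \<lbrakk>\<sigma> \<in> V \<rightarrow>\<^sub>E \<Phi>; \<tau> \<in> V \<rightarrow>\<^sub>E \<Phi>; \<And>a. a \<in> A \<Longrightarrow> \<sigma> a = \<tau> a\<rbrakk> \<Longrightarrow> Q \<sigma> = Q \<tau>"
  shows "{\<sigma> \<in> V \<rightarrow>\<^sub>E \<Phi>. Q \<sigma>} \<in> sets (events V \<Phi> S)"
proof -
  let ?B = "(\<lambda>\<sigma>. restrict \<sigma> A) ` {\<sigma> \<in> V \<rightarrow>\<^sub>E \<Phi>. Q \<sigma>}"
  have "Q \<sigma>" if "\<sigma> \<in> V \<rightarrow>\<^sub>E \<Phi>" "restrict \<sigma> A \<in> ?B" for \<sigma>
  proof -
    from that(2) obtain \<tau> where \<tau>: "\<tau> \<in> V \<rightarrow>\<^sub>E \<Phi>" "Q \<tau>" "restrict \<sigma> A = restrict \<tau> A" by blast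
    have "\<sigma> a = \<tau> a" if "a \<in> A" for a
      using fun_cong[OF \<tau>(3), of a] that by simp
    with loc[OF that(1) \<tau>(1)] \<tau>(2) show ?thesis by blast
  qed
  then have "{\<sigma> \<in> V \<rightarrow>\<^sub>E \<Phi>. Q \<sigma>} = {\<sigma> \<in> V \<rightarrow>\<^sub>E \<Phi>. restrict \<sigma> A \<in> ?B}"
    by blast
  moreover have "?B \<subseteq> (A \<rightarrow>\<^sub>E \<Phi>)" using assms(1,3) by (auto simp: PiE_iff)
  ultimately show ?thesis
    unfolding sets_events using assms(2,3) by (intro sigma_sets.Basic) blast
qed

text \<open>Generating cylinders see only coordinates in \<open>S\<close>, and this insensitivity
  survives complements and countable unions.\<close>

lemma events_agree:
  assumes "B \<in> sets (events V \<Phi> S)" "\<sigma> \<in> V \<rightarrow>\<^sub>E \<Phi>" "\<tau> \<in> V \<rightarrow>\<^sub>E \<Phi>"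
    and "\<And>a. a \<in> S \<Longrightarrow> \<sigma> a = \<tau> a"
  shows "\<sigma> \<in> B \<longleftrightarrow> \<tau> \<in> B"
  using assms(1) unfolding sets_events
proof (induction rule: sigma_sets.induct)
  case (Basic B)
  then obtain A C where B: "B = {\<sigma> \<in> V \<rightarrow>\<^sub>E \<Phi>. restrict \<sigma> A \<in> C}" "A \<subseteq> S" by blast
  then have "restrict \<sigma> A = restrict \<tau> A" using assms(4) by (intro restrict_ext) auto
  with B assms(2,3) show ?case by simp
qed (use assms(2,3) in auto)

lemma override_on_PiE:
  assumes "\<omega> \<in> V \<rightarrow>\<^sub>E \<Phi>" "s \<in> W \<rightarrow>\<^sub>E \<Phi>" "W \<subseteq> V"
  shows "override_on \<omega> s W \<in> V \<rightarrow>\<^sub>E \<Phi>"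
  using assms by (auto simp: override_on_def PiE_iff extensional_def)

text \<open>Checked on generating cylinders: with the coordinates in \<open>W\<close> frozen to
  \<open>s\<close>, a condition on \<open>A\<close> becomes a condition on \<open>A - W\<close>,
  hence an event outside \<open>W\<close>.\<close>

lemma measurable_override_on:
  assumes s: "s \<in> W \<rightarrow>\<^sub>E \<Phi>" and W: "W \<subseteq> V"
  shows "(\<lambda>\<omega>. override_on \<omega> s W) \<in> events V \<Phi> (V - W) \<rightarrow>\<^sub>M events V \<Phi> V"
  unfolding events_def[of V \<Phi> V]
proof (rule measurable_measure_of)
  show "(\<lambda>\<omega>. override_on \<omega> s W) \<in> space (events V \<Phi> (V - W)) \<rightarrow> (V \<rightarrow>\<^sub>E \<Phi>)"
    using override_on_PiE[OF _ s W] by simp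
next
  fix y
  assume "y \<in> {{\<sigma> \<in> V \<rightarrow>\<^sub>E \<Phi>. restrict \<sigma> A \<in> B} | A B. finite A \<and> A \<subseteq> V \<and> B \<subseteq> (A \<rightarrow>\<^sub>E \<Phi>)}"
  then obtain A B where y: "y = {\<sigma> \<in> V \<rightarrow>\<^sub>E \<Phi>. restrict \<sigma> A \<in> B}" and A: "finite A" "A \<subseteq> V"
    by blast
  have "(\<lambda>\<omega>. override_on \<omega> s W) -` y \<inter> space (events V \<Phi> (V - W))
      = {\<omega> \<in> V \<rightarrow>\<^sub>E \<Phi>. restrict (override_on \<omega> s W) A \<in> B}"
    using override_on_PiE[OF _ s W] by (auto simp: y)
  also have "\<dots> \<in> sets (events V \<Phi> (V - W))"
  proof (rule local_event[where A = "A - W"])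
    fix \<sigma> \<tau> :: "'a \<Rightarrow> 'b" assume "\<And>a. a \<in> A - W \<Longrightarrow> \<sigma> a = \<tau> a"
    then have "restrict (override_on \<sigma> s W) A = restrict (override_on \<tau> s W) A"
      by (intro restrict_ext) (simp add: override_on_def)
    then show "(restrict (override_on \<sigma> s W) A \<in> B) = (restrict (override_on \<tau> s W) A \<in> B)"
      by simp
  qed (use A in auto)
  finally show "(\<lambda>\<omega>. override_on \<omega> s W) -` y \<inter> space (events V \<Phi> (V - W))
      \<in> sets (events V \<Phi> (V - W))" .
qed blast


section \<open>Kernels of a weight\<close>

locale weighted_configurations =
  fixes V :: "'v set" and \<Phi> :: "'s set" and w :: "('v \<Rightarrow> 's) \<Rightarrow> ennreal"
  assumes countable_spins: "countable \<Phi>"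
    and weight_measurable [measurable]: "w \<in> borel_measurable (events V \<Phi> V)"
begin

definition total :: "'v set \<Rightarrow> ('v \<Rightarrow> 's) \<Rightarrow> ennreal" where
  "total W \<omega> = (\<integral>\<^sup>+ s. w (override_on \<omega> s W) \<partial>count_space (W \<rightarrow>\<^sub>E \<Phi>))"

definition kernel :: "'v set \<Rightarrow> ('v \<Rightarrow> 's) \<Rightarrow> ('v \<Rightarrow> 's) set \<Rightarrow> ennreal" where
  "kernel W \<omega> A = (\<integral>\<^sup>+ s. indicator A (override_on \<omega> s W)
     * (w (override_on \<omega> s W) / total W \<omega>) \<partial>count_space (W \<rightarrow>\<^sub>E \<Phi>))"

text \<open>Pushforward of the normalized weights under resampling on \<open>W\<close>. Countable
  additivity comes with this construction and is carried over to the formula \<open>kernel\<close>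
  later.\<close>

definition kernel_measure :: "'v set \<Rightarrow> ('v \<Rightarrow> 's) \<Rightarrow> ('v \<Rightarrow> 's) measure" where
  "kernel_measure W \<omega> =
     distr (density (count_space (W \<rightarrow>\<^sub>E \<Phi>)) (\<lambda>s. w (override_on \<omega> s W) / total W \<omega>))
       (events V \<Phi> V) (\<lambda>s. override_on \<omega> s W)"

text \<open>In \<open>ennreal\<close> a quotient \<open>z / z\<close> equals 1 only if
  \<open>z\<close> is neither 0 nor infinite; the two bounds secure this for the partition
  functions.\<close>

definition admissible :: "'v set \<Rightarrow> bool" where
  "admissible W \<longleftrightarrow> finite W \<and> W \<subseteq> V \<and> (\<forall>\<omega> \<in> V \<rightarrow>\<^sub>E \<Phi>. 0 < total W \<omega> \<and> total W \<omega> < \<infinity>)"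

section \<open>Integration against the kernel measures\<close>

lemma countable_PiE_spins: "finite W \<Longrightarrow> countable (W \<rightarrow>\<^sub>E \<Phi>)"
  using countable_spins by (intro countable_PiE) auto

lemma sets_kernel_measure [simp]: "sets (kernel_measure W \<omega>) = sets (events V \<Phi> V)"
  and space_kernel_measure [simp]: "space (kernel_measure W \<omega>) = V \<rightarrow>\<^sub>E \<Phi>"
  by (simp_all add: kernel_measure_def)

lemma measurable_override_count_space:
  assumes "\<omega> \<in> V \<rightarrow>\<^sub>E \<Phi>" "W \<subseteq> V"
  shows "(\<lambda>s. override_on \<omega> s W) \<in> count_space (W \<rightarrow>\<^sub>E \<Phi>) \<rightarrow>\<^sub>M events V \<Phi> V"
  using override_on_PiE[OF assms(1) _ assms(2)] by simp

lemma nn_integral_kernel_measure: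
  assumes "\<omega> \<in> V \<rightarrow>\<^sub>E \<Phi>" "W \<subseteq> V" "f \<in> borel_measurable (events V \<Phi> V)"
  shows "(\<integral>\<^sup>+ \<tau>. f \<tau> \<partial>kernel_measure W \<omega>) = (\<integral>\<^sup>+ s. f (override_on \<omega> s W)
     * (w (override_on \<omega> s W) / total W \<omega>) \<partial>count_space (W \<rightarrow>\<^sub>E \<Phi>))"
proof -
  let ?d = "\<lambda>s. w (override_on \<omega> s W) / total W \<omega>"
  have "(\<integral>\<^sup>+ \<tau>. f \<tau> \<partial>kernel_measure W \<omega>)
      = (\<integral>\<^sup>+ s. f (override_on \<omega> s W) \<partial>density (count_space (W \<rightarrow>\<^sub>E \<Phi>)) ?d)"
    unfolding kernel_measure_def
    using measurable_override_count_space[OF assms(1,2)] assms(3)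
    by (intro nn_integral_distr) simp_all
  also have "\<dots> = (\<integral>\<^sup>+ s. ?d s * f (override_on \<omega> s W) \<partial>count_space (W \<rightarrow>\<^sub>E \<Phi>))"
    by (rule nn_integral_density) simp_all
  finally show ?thesis by (simp only: mult.commute)
qed

lemma emeasure_kernel_measure:
  assumes "\<omega> \<in> V \<rightarrow>\<^sub>E \<Phi>" "W \<subseteq> V" "A \<in> sets (events V \<Phi> V)"
  shows "emeasure (kernel_measure W \<omega>) A = kernel W \<omega> A"
  using nn_integral_kernel_measure[OF assms(1,2), of "indicator A"] assms(3)
  by (simp add: kernel_def)

text \<open>The partition function of \<open>U\<close> sums over all values on \<open>U\<close>, so
  it does not see changes of the configuration inside \<open>U\<close>.\<close>

lemma total_override:
  assumes "W \<subseteq> U"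
  shows "total U (override_on \<omega> s W) = total U \<omega>"
proof -
  have "override_on (override_on \<omega> s W) t U = override_on \<omega> t U" for t
    using assms by (intro ext) (auto simp: override_on_def)
  then show ?thesis by (simp add: total_def)
qed

section \<open>Normalization, measurability and properness\<close>

lemma nn_integral_weight_normalized:
  assumes "admissible W" "\<omega> \<in> V \<rightarrow>\<^sub>E \<Phi>"
  shows "(\<integral>\<^sup>+ s. w (override_on \<omega> s W) / total W \<omega> \<partial>count_space (W \<rightarrow>\<^sub>E \<Phi>)) = 1"
proof -
  have "0 < total W \<omega>" "total W \<omega> < \<infinity>"
    using assms by (auto simp: admissible_def)
  then show ?thesis
    by (simp add: nn_integral_divide total_def[symmetric] ennreal_divide_self)
qed

text \<open>For fixed \<open>s\<close> the integrand depends on \<omega> only through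
  \<open>override_on \<omega> s W\<close>, which is measurable with respect to the events outside
  \<open>W\<close>; countable sums and quotients keep this.\<close>

lemma kernel_measurable:
  assumes "admissible W" "A \<in> sets (events V \<Phi> V)"
  shows "(\<lambda>\<omega>. kernel W \<omega> A) \<in> borel_measurable (events V \<Phi> (V - W))"
proof -
  have W: "finite W" "W \<subseteq> V" using assms(1) by (auto simp: admissible_def)
  note [measurable] = assms(2)
  have ov: "(\<lambda>\<omega>. override_on \<omega> s W) \<in> events V \<Phi> (V - W) \<rightarrow>\<^sub>M events V \<Phi> V"
    if "s \<in> W \<rightarrow>\<^sub>E \<Phi>" for s
    using measurable_override_on[OF that W(2)] .
  have wm: "(\<lambda>\<omega>. w (override_on \<omega> s W)) \<in> borel_measurable (events V \<Phi> (V - W))"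
    if "s \<in> W \<rightarrow>\<^sub>E \<Phi>" for s
    by (rule measurable_compose[OF ov[OF that]]) measurable
  have im: "(\<lambda>\<omega>. indicator A (override_on \<omega> s W) :: ennreal) \<in> borel_measurable (events V \<Phi> (V - W))"
    if "s \<in> W \<rightarrow>\<^sub>E \<Phi>" for s
    by (rule measurable_compose[OF ov[OF that]]) measurable
  have tm: "total W \<in> borel_measurable (events V \<Phi> (V - W))"
    unfolding total_def
    by (rule borel_measurable_nn_integral_count_space[OF countable_PiE_spins[OF W(1)] wm])
  show ?thesis
    unfolding kernel_def
    by (rule borel_measurable_nn_integral_count_space[OF countable_PiE_spins[OF W(1)]])
       (rule borel_measurable_times_ennreal[OF im borel_measurable_divide_ennreal[OF wm tm]])
qed

text \<open>Resampling on \<open>W\<close> cannot change membership in an event outside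
  \<open>W\<close>, so the indicator leaves the integral and a total mass of 1 remains.\<close>

lemma kernel_proper:
  assumes "admissible W" "\<omega> \<in> V \<rightarrow>\<^sub>E \<Phi>" "B \<in> sets (events V \<Phi> (V - W))"
  shows "kernel W \<omega> B = indicator B \<omega>"
proof -
  have W: "W \<subseteq> V" using assms(1) by (auto simp: admissible_def)
  have "indicator B (override_on \<omega> s W) = (indicator B \<omega> :: ennreal)" if "s \<in> W \<rightarrow>\<^sub>E \<Phi>" for s
  proof -
    have "override_on \<omega> s W \<in> B \<longleftrightarrow> \<omega> \<in> B"
      by (rule events_agree[OF assms(3) override_on_PiE[OF assms(2) that W] assms(2)]) simp
    then show ?thesis by (simp add: indicator_def)
  qed
  then have "kernel W \<omega> B =
      (\<integral>\<^sup>+ s. indicator B \<omega> * (w (override_on \<omega> s W) / total W \<omega>) \<partial>count_space (W \<rightarrow>\<^sub>E \<Phi>))"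
    unfolding kernel_def by (intro nn_integral_cong) simp
  also have "\<dots> = indicator B \<omega> * (\<integral>\<^sup>+ s. w (override_on \<omega> s W) / total W \<omega>
      \<partial>count_space (W \<rightarrow>\<^sub>E \<Phi>))"
    by (rule nn_integral_cmult) simp
  finally show ?thesis
    by (simp only: nn_integral_weight_normalized[OF assms(1,2)] mult_1_right)
qed

section \<open>Consistency for nested boxes\<close>

lemma kernel_consistent:
  assumes U: "admissible U" and W: "admissible W" and "U \<subseteq> W"
    and \<omega>: "\<omega> \<in> V \<rightarrow>\<^sub>E \<Phi>" and A: "A \<in> sets (events V \<Phi> V)"
  shows "(\<integral>\<^sup>+ s. kernel U (override_on \<omega> s W) A
     * (w (override_on \<omega> s W) / total W \<omega>) \<partial>count_space (W \<rightarrow>\<^sub>E \<Phi>)) = kernel W \<omega> A"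
proof -
  let ?EW = "W \<rightarrow>\<^sub>E \<Phi>" and ?EU = "U \<rightarrow>\<^sub>E \<Phi>"
  define x where "x s = override_on \<omega> s W" for s
  define y where "y s t = override_on (x s) t U" for s t
  \<comment> \<open>The integrand after the exchange: \<open>t\<close> enters only through
    \<open>w (y s t)\<close>, so the sum over \<open>t\<close> can be evaluated in closed
    form.\<close>
  define F where "F = (\<lambda>(s, t). indicator A (x s) * (w (x s) / total U (x s)) * (w (y s t) / total W \<omega>))"
  define swap :: "('v \<Rightarrow> 's) \<times> ('v \<Rightarrow> 's) \<Rightarrow> _"
    where "swap = (\<lambda>(s, t). (override_on s t U, restrict s U))"
  have fin: "finite U" "finite W" and sub: "W \<subseteq> V" using U W by (auto simp: admissible_def)
  interpret sigma_finite_measure "count_space ?EU"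
    by (intro sigma_finite_measure_count_space_countable countable_PiE_spins fin)
  \<comment> \<open>On countable sets the product of counting measures is again a counting measure,
    so a bijection of the pairs is a valid change of variables.\<close>
  have pair: "count_space ?EW \<Otimes>\<^sub>M count_space ?EU = count_space (?EW \<times> ?EU)"
    by (intro pair_measure_countable countable_PiE_spins fin)
  have fubini: "(\<integral>\<^sup>+ s. \<integral>\<^sup>+ t. f (s, t) \<partial>count_space ?EU \<partial>count_space ?EW)
      = (\<integral>\<^sup>+ p. f p \<partial>count_space (?EW \<times> ?EU))" for f :: "_ \<Rightarrow> ennreal"
    unfolding pair[symmetric] by (rule nn_integral_fst) (simp add: pair)
  have swap_swap: "swap (swap p) = p" and swap_in: "swap p \<in> ?EW \<times> ?EU" if "p \<in> ?EW \<times> ?EU" for p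
    using that \<open>U \<subseteq> W\<close>
    by (auto simp: swap_def override_on_def PiE_iff extensional_def intro!: ext)
  have bij: "bij_betw swap (?EW \<times> ?EU) (?EW \<times> ?EU)"
    by (rule bij_betw_byWitness[where f' = swap])
       (blast intro: swap_swap swap_in)+
  \<comment> \<open>The swap exchanges \<open>x s\<close> and \<open>y s t\<close>. These differ
    only on \<open>U\<close>, so they share the same partition function of \<open>U\<close>, and
    \<open>F\<close> after the swap is the integrand of the composed kernels.\<close>
  have F_swap: "F (swap (s, t)) = indicator A (y s t) * (w (y s t) / total U (x s)) * (w (x s) / total W \<omega>)"
    if "s \<in> ?EW" "t \<in> ?EU" for s t
  proof -
    have "x (override_on s t U) = y s t" "y (override_on s t U) (restrict s U) = x s"
      using \<open>U \<subseteq> W\<close> by (auto simp: x_def y_def override_on_def intro!: ext)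
    moreover have "total U (y s t) = total U (x s)"
      unfolding y_def by (rule total_override) simp
    ultimately show ?thesis by (simp add: F_def swap_def)
  qed
  have F_inner: "(\<integral>\<^sup>+ t. F (s, t) \<partial>count_space ?EU) = indicator A (x s) * (w (x s) / total W \<omega>)"
    if "s \<in> ?EW" for s
  proof -
    have "x s \<in> V \<rightarrow>\<^sub>E \<Phi>" unfolding x_def by (rule override_on_PiE[OF \<omega> that sub])
    then have z: "0 < total U (x s)" "total U (x s) < \<infinity>"
      using U by (auto simp: admissible_def)
    have "(\<integral>\<^sup>+ t. F (s, t) \<partial>count_space ?EU)
        = indicator A (x s) * (w (x s) / total U (x s)) * (\<integral>\<^sup>+ t. w (y s t) / total W \<omega> \<partial>count_space ?EU)"
      unfolding F_def prod.case by (rule nn_integral_cmult) simp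
    \<comment> \<open>The inner sum is the partition function of \<open>U\<close> at
      \<open>x s\<close>; it cancels against the denominator of \<open>F\<close>.\<close>
    also have "(\<integral>\<^sup>+ t. w (y s t) / total W \<omega> \<partial>count_space ?EU) = total U (x s) / total W \<omega>"
      unfolding y_def total_def[of U] by (rule nn_integral_divide) simp
    also have "indicator A (x s) * (w (x s) / total U (x s)) * (total U (x s) / total W \<omega>)
        = indicator A (x s) * (w (x s) / total W \<omega> * (total U (x s) / total U (x s)))"
      by (simp only: divide_ennreal_def ac_simps)
    also have "total U (x s) / total U (x s) = 1"
      using z by (intro ennreal_divide_self) auto
    finally show ?thesis by (simp only: mult_1_right)
  qed
  have "kernel U (x s) A * (w (x s) / total W \<omega>) = (\<integral>\<^sup>+ t. F (swap (s, t)) \<partial>count_space ?EU)"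
    if "s \<in> ?EW" for s
  proof -
    have "kernel U (x s) A * (w (x s) / total W \<omega>) = (\<integral>\<^sup>+ t. indicator A (y s t)
        * (w (y s t) / total U (x s)) * (w (x s) / total W \<omega>) \<partial>count_space ?EU)"
      unfolding kernel_def y_def by (rule nn_integral_multc[symmetric]) simp
    also have "\<dots> = (\<integral>\<^sup>+ t. F (swap (s, t)) \<partial>count_space ?EU)"
      using that by (intro nn_integral_cong F_swap[symmetric]) simp_all
    finally show ?thesis .
  qed
  then have "(\<integral>\<^sup>+ s. kernel U (x s) A * (w (x s) / total W \<omega>) \<partial>count_space ?EW)
      = (\<integral>\<^sup>+ s. \<integral>\<^sup>+ t. F (swap (s, t)) \<partial>count_space ?EU \<partial>count_space ?EW)"
    by (intro nn_integral_cong) simp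
  also have "\<dots> = (\<integral>\<^sup>+ p. F (swap p) \<partial>count_space (?EW \<times> ?EU))"
    by (rule fubini)
  also have "\<dots> = (\<integral>\<^sup>+ p. F p \<partial>count_space (?EW \<times> ?EU))"
    by (rule nn_integral_bij_count_space[OF bij])
  also have "\<dots> = (\<integral>\<^sup>+ s. \<integral>\<^sup>+ t. F (s, t) \<partial>count_space ?EU \<partial>count_space ?EW)"
    by (rule fubini[symmetric])
  also have "\<dots> = kernel W \<omega> A"
    unfolding kernel_def x_def[symmetric] by (intro nn_integral_cong) (simp add: F_inner)
  finally show ?thesis by (simp add: x_def)
qed

section \<open>From the kernel formula to measures\<close>

lemma sigma_sets_events: "sigma_sets (V \<rightarrow>\<^sub>E \<Phi>) (sets (events V \<Phi> V)) = sets (events V \<Phi> V)"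
  using sets.sigma_sets_eq[of "events V \<Phi> V"] by simp

lemma events_closed: "sets (events V \<Phi> V) \<subseteq> Pow (V \<rightarrow>\<^sub>E \<Phi>)"
  using sets.space_closed[of "events V \<Phi> V"] by simp

text \<open>\<open>measure_of\<close> uses the set function only on the generated events, where
  \<open>kernel\<close> agrees with the measure already constructed.\<close>

lemma measure_of_kernel:
  assumes "\<omega> \<in> V \<rightarrow>\<^sub>E \<Phi>" "W \<subseteq> V"
  shows "measure_of (V \<rightarrow>\<^sub>E \<Phi>) (sets (events V \<Phi> V)) (kernel W \<omega>) = kernel_measure W \<omega>"
proof -
  have "measure_of (V \<rightarrow>\<^sub>E \<Phi>) (sets (events V \<Phi> V)) (kernel W \<omega>)
      = measure_of (V \<rightarrow>\<^sub>E \<Phi>) (sets (events V \<Phi> V)) (emeasure (kernel_measure W \<omega>))"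
    by (intro measure_of_eq events_closed) (simp add: sigma_sets_events emeasure_kernel_measure assms)
  also have "\<dots> = kernel_measure W \<omega>"
    using measure_of_of_measure[of "kernel_measure W \<omega>"] by simp
  finally show ?thesis .
qed

lemma measure_space_kernel:
  assumes "\<omega> \<in> V \<rightarrow>\<^sub>E \<Phi>" "W \<subseteq> V"
  shows "measure_space (V \<rightarrow>\<^sub>E \<Phi>) (sets (events V \<Phi> V)) (kernel W \<omega>)"
proof -
  have "measure_space (V \<rightarrow>\<^sub>E \<Phi>) (sets (events V \<Phi> V)) (emeasure (kernel_measure W \<omega>))"
    using measure_space[of "kernel_measure W \<omega>"] by simp
  also have "?this \<longleftrightarrow> ?thesis"
    using measure_space_eq[OF events_closed, of "emeasure (kernel_measure W \<omega>)" "kernel W \<omega>"]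
    by (simp add: sigma_sets_events emeasure_kernel_measure assms)
  finally show ?thesis .
qed

theorem is_specification_kernel:
  assumes "\<And>n. n \<ge> 1 \<Longrightarrow> admissible (W n)"
  shows "is_specification V \<Phi> W (\<lambda>n. kernel (W n))"
proof -
  have W: "W n \<subseteq> V" if "n \<ge> 1" for n using assms[OF that] by (simp add: admissible_def)
  \<comment> \<open>Integrating the inner kernel requires measurability for the full algebra of
    events, which contains the events outside \<open>W n\<close>.\<close>
  have km: "(\<lambda>\<tau>. kernel (W n) \<tau> A) \<in> borel_measurable (events V \<Phi> V)"
    if "n \<ge> 1" "A \<in> sets (events V \<Phi> V)" for n A
  proof (rule measurable_mono[THEN subsetD, OF _ _ _ _ kernel_measurable[OF assms[OF that(1)] that(2)]])
    show "sets (events V \<Phi> (V - W n)) \<subseteq> sets (events V \<Phi> V)"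
      unfolding sets_events by (intro sigma_sets_mono') blast
  qed simp_all
  \<comment> \<open>Mass 1 is properness applied to the whole space, which is an event outside every
    box.\<close>
  have "kernel (W n) \<omega> (V \<rightarrow>\<^sub>E \<Phi>) = 1" if "n \<ge> 1" "\<omega> \<in> V \<rightarrow>\<^sub>E \<Phi>" for n \<omega>
    using kernel_proper[OF assms[OF that(1)] that(2), of "V \<rightarrow>\<^sub>E \<Phi>"] that(2)
      sets.top[of "events V \<Phi> (V - W n)"] by simp
  moreover have "(\<integral>\<^sup>+ \<tau>. kernel (W n) \<tau> A
      \<partial>measure_of (V \<rightarrow>\<^sub>E \<Phi>) (sets (events V \<Phi> V)) (kernel (W m) \<omega>)) = kernel (W m) \<omega> A"
    if "m \<ge> 1" "n \<ge> 1" "W n \<subseteq> W m" "\<omega> \<in> V \<rightarrow>\<^sub>E \<Phi>" "A \<in> sets (events V \<Phi> V)" for m n \<omega> A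
    using that assms W km
    by (simp add: measure_of_kernel nn_integral_kernel_measure kernel_consistent)
  ultimately show ?thesis
    unfolding is_specification_def
    using assms W measure_space_kernel kernel_measurable kernel_proper by simp
qed

end


section \<open>The Boltzmann weight\<close>

lemma exp_uminus_measurable [measurable]: "exp_uminus \<in> borel_measurable borel"
proof -
  \<comment> \<open>Splitting off the two infinite values leaves a composition of measurable real
    functions.\<close>
  have "exp_uminus = (\<lambda>h. if h = \<infinity> then 0 else if h = -\<infinity> then \<infinity>
      else ennreal (exp (- real_of_ereal h)))"
    by (auto simp: exp_uminus_def fun_eq_iff split: ereal.split)
  then show ?thesis
    by (subst \<open>exp_uminus = _\<close>) measurable
qed

text \<open>The preimage of any set whatsoever is determined by the finitely many coordinates in
  \<open>A\<close>, hence is an event.\<close>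

lemma local_borel_measurable:
  fixes f :: "('v \<Rightarrow> 's) \<Rightarrow> 'b :: topological_space"
  assumes "finite A" "A \<subseteq> V"
    and "\<And>\<sigma> \<tau>. \<lbrakk>\<sigma> \<in> V \<rightarrow>\<^sub>E \<Phi>; \<tau> \<in> V \<rightarrow>\<^sub>E \<Phi>; \<And>a. a \<in> A \<Longrightarrow> \<sigma> a = \<tau> a\<rbrakk> \<Longrightarrow> f \<sigma> = f \<tau>"
  shows "f \<in> borel_measurable (events V \<Phi> V)"
proof (rule measurableI)
  fix B :: "'b set"
  have "f -` B \<inter> space (events V \<Phi> V) = {\<sigma> \<in> V \<rightarrow>\<^sub>E \<Phi>. f \<sigma> \<in> B}" by auto
  also have "\<dots> \<in> sets (events V \<Phi> V)"
  proof (rule local_event[OF subset_refl assms(1,2)])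
    fix \<sigma> \<tau> assume "\<sigma> \<in> V \<rightarrow>\<^sub>E \<Phi>" "\<tau> \<in> V \<rightarrow>\<^sub>E \<Phi>" "\<And>a. a \<in> A \<Longrightarrow> \<sigma> a = \<tau> a"
    then have "f \<sigma> = f \<tau>" by (rule assms(3))
    then show "(f \<sigma> \<in> B) = (f \<tau> \<in> B)" by simp
  qed
  finally show "f -` B \<inter> space (events V \<Phi> V) \<in> sets (events V \<Phi> V)" .
qed simp

lemma hamiltonian_measurable:
  assumes "is_potential (pverts G) \<Phi> P"
    and fin: "\<And>n. finite (vertex_box G x0 n)"
    and sum: "\<And>\<sigma>. \<sigma> \<in> pverts G \<rightarrow>\<^sub>E \<Phi> \<Longrightarrow> summable (\<lambda>j. P (vertex_box G x0 (Suc j)) \<sigma>)"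
  shows "hamiltonian G x0 P n \<in> borel_measurable (events (pverts G) \<Phi> (pverts G))"
proof -
  have P: "P (vertex_box G x0 j) \<in> borel_measurable (events (pverts G) \<Phi> (pverts G))" for j
  proof (rule local_borel_measurable[OF fin vertex_box_subset])
    fix \<sigma> \<tau> assume "\<sigma> \<in> pverts G \<rightarrow>\<^sub>E \<Phi>" "\<tau> \<in> pverts G \<rightarrow>\<^sub>E \<Phi>"
      and "\<And>a. a \<in> vertex_box G x0 j \<Longrightarrow> \<sigma> a = \<tau> a"
    moreover from this(3) have "restrict \<sigma> (vertex_box G x0 j) = restrict \<tau> (vertex_box G x0 j)"
      by (intro restrict_ext) simp
    ultimately show "P (vertex_box G x0 j) \<sigma> = P (vertex_box G x0 j) \<tau>"
      using assms(1) fin[of j] vertex_box_subset[of G x0 j] unfolding is_potential_def by blast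
  qed
  let ?S = "\<lambda>N \<sigma>. \<Sum>j<N. P (vertex_box G x0 (Suc j)) \<sigma>"
  \<comment> \<open>Terms of either sign may occur, so the series is treated as a limit: summability
    makes it equal to the \<open>liminf\<close> of its partial sums, each a finite sum of local
    functions. The equality is claimed only on the configuration space, which suffices for
    measurability.\<close>
  have "hamiltonian G x0 P n \<sigma> = liminf (\<lambda>N. ?S N \<sigma>)" if "\<sigma> \<in> pverts G \<rightarrow>\<^sub>E \<Phi>" for \<sigma>
    using lim_imp_Liminf[OF _ summable_LIMSEQ[OF sum[OF that]]]
    by (simp add: hamiltonian_def)
  moreover have "(\<lambda>\<sigma>. liminf (\<lambda>N. ?S N \<sigma>)) \<in> borel_measurable (events (pverts G) \<Phi> (pverts G))"
    by (intro borel_measurable_liminf borel_measurable_ereal_sum P)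
  ultimately show ?thesis
    by (subst measurable_cong) auto
qed

section \<open>Specialization to the Boltzmann-Gibbs kernels\<close>

theorem theorem2:
  fixes G :: "'v pair_pre_digraph" and k :: nat and x0 :: 'v
    and \<Phi> :: "ennreal set" and P :: "('v, ennreal) potential"
  assumes "cayley_tree G k"
    and "x0 \<in> pverts G"
    and "\<Phi> \<noteq> {}" and "countable \<Phi>"
    and "is_potential (pverts G) \<Phi> P"
    and "finite_range G \<Phi> P \<or> abs_summable (pverts G) \<Phi> P"
    and "\<And>n \<sigma>. n \<ge> 1 \<Longrightarrow> \<sigma> \<in> pverts G \<rightarrow>\<^sub>E \<Phi> \<Longrightarrow> hamiltonian_well_defined G x0 P n \<sigma>"
    and "\<And>n \<omega>. n \<ge> 1 \<Longrightarrow> \<omega> \<in> pverts G \<rightarrow>\<^sub>E \<Phi> \<Longrightarrow>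
           0 < partition_function G x0 \<Phi> P n \<omega> \<and> partition_function G x0 \<Phi> P n \<omega> < \<infinity>"
  shows "is_specification (pverts G) \<Phi> (vertex_box G x0) (gibbs_kernel G x0 \<Phi> P)"
proof -
  interpret cayley_tree G k by fact
  \<comment> \<open>The index 0 is an arbitrary choice, as the defining series is the same for every
    box.\<close>
  define H where "H = hamiltonian G x0 P 0"
  have H: "hamiltonian G x0 P n = H" for n
    by (simp add: H_def hamiltonian_def fun_eq_iff)
  have "H \<in> borel_measurable (events (pverts G) \<Phi> (pverts G))"
    unfolding H_def
    using assms(5,7) finite_vertex_box
    by (intro hamiltonian_measurable) (auto simp: hamiltonian_well_defined_def)
  then interpret weighted_configurations "pverts G" \<Phi> "\<lambda>\<sigma>. exp_uminus (H \<sigma>)"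
    by unfold_locales (auto intro: assms(4))
  have sum_eq: "infsum f (vertex_box G x0 n \<rightarrow>\<^sub>E \<Phi>)
      = (\<integral>\<^sup>+ s. f s \<partial>count_space (vertex_box G x0 n \<rightarrow>\<^sub>E \<Phi>))" for f :: "_ \<Rightarrow> ennreal" and n
    by (intro infsum_ennreal_eq_nn_integral countable_PiE_spins finite_vertex_box)
  \<comment> \<open>Reading the unordered sums as integrals identifies the partition functions with
    \<open>total\<close>, so the assumed bounds on them are exactly those in
    \<open>admissible\<close>.\<close>
  have Z: "partition_function G x0 \<Phi> P n \<omega> = total (vertex_box G x0 n) \<omega>" for n \<omega>
    by (simp add: partition_function_def total_def sum_eq H)
  have "gibbs_kernel G x0 \<Phi> P = (\<lambda>n. kernel (vertex_box G x0 n))"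
    by (simp add: fun_eq_iff gibbs_kernel_def kernel_def gibbs_weight_def sum_eq H Z)
  moreover have "admissible (vertex_box G x0 n)" if "n \<ge> 1" for n
    using assms(8)[OF that] by (simp add: admissible_def Z finite_vertex_box vertex_box_subset)
  ultimately show ?thesis
    by (simp add: is_specification_kernel)
qed

end
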